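(* Let $n$ be a positive integer which is not a power of an integer (that is, $n$ is not of the form $m^k$ with $m,k$ integers and $k\ge 2$). Suppose that there exist a prime $r$ and an integer $\alpha\ge 1$ such that $r^\alpha \,\|\, n-1$ and $r\ge (\log n)^2$. Suppose in addition that there exists an integer $a$ with $1<a<n$ such that $a^{r^\alpha}\equiv 1 \pmod n$, $\gcd(a^{r^{\alpha-1}}-1,\,n)=1$, and $$(1+x)^n \equiv 1+x^n \pmod{n,\ x^r-a}.$$ Then $n$ is a prime.
   Context: $\log$ denotes the logarithm to base $2$. For a prime $r$, the notation $r^\alpha\,\|\,N$ means that $r^\alpha$ divides $N$ but $r^{\alpha+1}$ does not divide $N$. The congruence modulo $(n, x^r-a)$ is congruence in the polynomial ring $\mathbb{Z}[x]$ modulo the ideal generated by $n$ and $x^r-a$. *)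

theory Defs
  imports Complex_Main "HOL-Computational_Algebra.Polynomial"
    "HOL-Computational_Algebra.Primes" "HOL-Number_Theory.Cong"
begin

text \<open>A commutative ring acts on itself by multiplication; the submodule spanned by
  a set is then the ideal which that set generates.\<close>

definition ideal_generated :: "'a::comm_ring_1 set \<Rightarrow> 'a set" where
  "ideal_generated S = module.span (*) S"

definition cong_mod_ideal :: "'a::comm_ring_1 \<Rightarrow> 'a \<Rightarrow> 'a set \<Rightarrow> bool" where
  "cong_mod_ideal p q S \<longleftrightarrow> p - q \<in> ideal_generated S"

lemma module_mult: "module ((*) :: 'a::comm_ring_1 \<Rightarrow> 'a \<Rightarrow> 'a)"
  by standard (simp_all add: algebra_simps)

lemma cong_mod_ideal_pair_iff:
  fixes p q f g :: "'a::comm_ring_1"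
  shows "cong_mod_ideal p q {f, g} \<longleftrightarrow> (\<exists>u v. p - q = u * f + v * g)"
proof -
  interpret module "(*) :: 'a \<Rightarrow> 'a \<Rightarrow> 'a" by (rule module_mult)
  have "p - q \<in> span {f, g} \<longleftrightarrow> (\<exists>u v. p - q - u * f = v * g)"
    by (simp add: span_insert span_singleton image_iff)
  then show ?thesis
    by (simp add: cong_mod_ideal_def ideal_generated_def diff_eq_eq add.commute)
qed

definition exactly_divides :: "'a::comm_semiring_1 \<Rightarrow> nat \<Rightarrow> 'a \<Rightarrow> bool" where
  "exactly_divides r \<alpha> N \<longleftrightarrow> r ^ \<alpha> dvd N \<and> \<not> r ^ (\<alpha> + 1) dvd N"

end

theory Submission
  imports "HOL-Number_Theory.Pocklington" Defs
begin

text \<open>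
  Suppose that \<open>n\<close> is composite. Every prime \<open>p\<close> dividing \<open>n\<close> sees \<open>a\<close> as an element of order
  \<open>r ^ \<alpha>\<close>, because \<open>a ^ r ^ (\<alpha> - 1) - 1\<close> is a unit modulo \<open>n\<close>; in particular \<open>r\<close> divides
  \<open>p - 1\<close>. For at least one of these primes \<open>r ^ (\<alpha> + 1)\<close> does not divide \<open>p - 1\<close>, and such a
  prime is kept from now on. Then \<open>a\<close> is not an \<open>r\<close>-th power modulo \<open>p\<close>, which is the same as
  \<open>z = a ^ ((p - 1) / r)\<close> not being 1, so \<open>z\<close> is a primitive \<open>r\<close>-th root of unity.

  Let \<open>K\<close> be the field obtained from the prime field by adjoining an \<open>r\<close>-th root \<open>x\<close> of \<open>a\<close>.
  Raising to the power \<open>p\<close> fixes the prime field and sends \<open>x\<close> to \<open>z x\<close>. For every \<open>r\<close>-th root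
  of unity \<open>c\<close> it thus sends \<open>1 + c x\<close> to \<open>1 + c z x\<close>. The congruence assumed for \<open>n\<close> says,
  after substituting \<open>c x\<close> for \<open>x\<close>, that raising to the power \<open>n\<close> also multiplies \<open>c\<close> by some
  root of unity. Undoing one Frobenius map, the same is true of \<open>q = n / p\<close>, and then of every
  \<open>q ^ i * p ^ j\<close>. There are only \<open>r\<close> roots of unity but, with \<open>s = \<lfloor>sqrt r\<rfloor>\<close>, more than \<open>r\<close>
  pairs \<open>(i, j)\<close> with \<open>i, j \<le> s\<close>. Hence two different pairs give exponents \<open>m\<close> and \<open>m'\<close>
  that agree on all \<open>1 + c x\<close> and therefore on all their products.

  The element \<open>x\<close> has degree \<open>r\<close>, so the products of fewer than \<open>r\<close> distinct factors
  \<open>1 + z ^ k x\<close> are distinct and nonzero. Together with 0 they are \<open>2 ^ r\<close> roots of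
  \<open>X ^ m - X ^ m'\<close>, while \<open>m, m' \<le> n ^ s < 2 ^ r\<close> by the bound on \<open>r\<close>. So \<open>m = m'\<close>, that is,
  \<open>q ^ i * p ^ j = q ^ i' * p ^ j'\<close>. As \<open>n\<close> is neither prime nor a perfect power, \<open>q\<close> has a
  prime divisor other than \<open>p\<close>, and unique factorization contradicts this equality.

  The field \<open>K\<close> depends on \<open>p\<close>, \<open>r\<close> and \<open>a\<close>, so it cannot be a type. It is replaced by the
  ring of integer polynomials with congruence modulo a prime ideal \<open>P\<close> that contains \<open>p\<close> and
  \<open>x ^ r - a\<close>. Counting roots works modulo any prime ideal (\<open>coeff_mem_of_many_roots\<close>), and the
  degree of \<open>x\<close> follows from its \<open>r\<close> conjugates (\<open>dvd_coeff_of_small_degree\<close>).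
  The pigeonhole step is \<open>multiplicative_relation\<close>, and the step from roots of \<open>X ^ m - X ^ m'\<close>
  to \<open>m = m'\<close> is \<open>equal_action_imp_equal\<close>.
\<close>

section \<open>Congruence modulo a prime ideal\<close>

locale ring_ideal =
  fixes P :: "'a::comm_ring_1 set"
  assumes zero_mem: "0 \<in> P"
    and add_mem: "\<And>x y. x \<in> P \<Longrightarrow> y \<in> P \<Longrightarrow> x + y \<in> P"
    and mult_mem: "\<And>c x. x \<in> P \<Longrightarrow> c * x \<in> P"
begin

definition ideal_cong :: "'a \<Rightarrow> 'a \<Rightarrow> bool" (infix "\<approx>" 50) where
  "x \<approx> y \<longleftrightarrow> x - y \<in> P"

lemma mult_mem': "x \<in> P \<Longrightarrow> x * c \<in> P"
  using mult_mem[of x c] by (simp add: mult.commute)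

lemma uminus_mem: "x \<in> P \<Longrightarrow> - x \<in> P"
  using mult_mem[of x "-1"] by simp

lemma sum_mem: "(\<And>i. i \<in> A \<Longrightarrow> f i \<in> P) \<Longrightarrow> sum f A \<in> P"
proof (induction A rule: infinite_finite_induct)
  case (insert i A)
  have "sum f A \<in> P" by (rule insert.IH) (simp add: insert.prems)
  then show ?case using insert.hyps insert.prems by (simp add: add_mem)
qed (simp_all add: zero_mem)

lemma ideal_cong_refl [simp]: "x \<approx> x"
  by (simp add: ideal_cong_def zero_mem)

lemma ideal_cong_sym: "x \<approx> y \<Longrightarrow> y \<approx> x"
  using uminus_mem[of "x - y"] by (simp add: ideal_cong_def)

lemma ideal_cong_trans [trans]: "x \<approx> y \<Longrightarrow> y \<approx> z \<Longrightarrow> x \<approx> z"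
  using add_mem[of "x - y" "y - z"] by (simp add: ideal_cong_def)

lemma ideal_cong_add: "x \<approx> x' \<Longrightarrow> y \<approx> y' \<Longrightarrow> x + y \<approx> x' + y'"
  using add_mem[of "x - x'" "y - y'"] by (simp add: ideal_cong_def algebra_simps)

lemma ideal_cong_mult:
  assumes "x \<approx> x'" "y \<approx> y'"
  shows "x * y \<approx> x' * y'"
proof -
  have "x * y - x' * y' = y * (x - x') + x' * (y - y')"
    by (simp add: algebra_simps)
  then show ?thesis
    using assms by (simp add: ideal_cong_def add_mem mult_mem)
qed

lemma ideal_cong_power: "x \<approx> y \<Longrightarrow> x ^ k \<approx> y ^ k"
  by (induction k) (auto intro: ideal_cong_mult)

lemma ideal_cong_prod: "(\<And>i. i \<in> A \<Longrightarrow> f i \<approx> g i) \<Longrightarrow> prod f A \<approx> prod g A"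
proof (induction A rule: infinite_finite_induct)
  case (insert i A)
  have "prod f A \<approx> prod g A" by (rule insert.IH) (simp add: insert.prems)
  then show ?case using insert.hyps insert.prems by (simp add: ideal_cong_mult)
qed simp_all

lemma ideal_cong_mem: "x \<approx> y \<Longrightarrow> y \<in> P \<Longrightarrow> x \<in> P"
  using add_mem[of "x - y" y] by (simp add: ideal_cong_def)

end

locale prime_ideal = ring_ideal +
  assumes one_notin: "1 \<notin> P"
    and prime: "\<And>x y. x * y \<in> P \<Longrightarrow> x \<in> P \<or> y \<in> P"
begin

lemma power_memD: "x ^ k \<in> P \<Longrightarrow> x \<in> P"
proof (induction k)
  case 0
  then show ?case using one_notin by simp
next
  case (Suc k)
  then have "x \<in> P \<or> x ^ k \<in> P" using prime[of x "x ^ k"] by simp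
  then show ?case using Suc.IH by blast
qed

text \<open>Split off one root at a time: a root \<open>c\<close> gives \<open>f = (X - c) g + f(c)\<close> with \<open>f(c)\<close> in
  \<open>P\<close>, and \<open>P\<close> being prime makes every other root a root of \<open>g\<close>. Speaking of all coefficients
  of \<open>f\<close>, rather than of \<open>f = 0\<close>, replaces the passage to the quotient ring.\<close>

lemma coeff_mem_of_many_roots:
  assumes "degree f < card S"
    and "\<And>x. x \<in> S \<Longrightarrow> poly f x \<in> P"
    and "\<And>x y. x \<in> S \<Longrightarrow> y \<in> S \<Longrightarrow> x \<approx> y \<Longrightarrow> x = y"
  shows "coeff f i \<in> P"
  using assms
proof (induction "degree f" arbitrary: f S i rule: less_induct)
  case less
  have fin: "finite S" using less.prems(1) card.infinite by fastforce
  obtain c where c: "c \<in> S" using less.prems(1) by fastforce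
  define g where "g = synthetic_div f c"
  have f_eq: "f = [:-c, 1:] * g + [:poly f c:]"
    using synthetic_div_correct'[of c f] by (simp add: g_def)
  show ?case
  proof (cases "degree f = 0")
    case True
    then obtain b where "f = [:b:]" by (metis degree_eq_zeroE)
    then show ?thesis using less.prems(2)[OF c] zero_mem
      by (cases i) auto
  next
    case False
    have deg: "degree g = degree f - 1" by (simp add: g_def degree_synthetic_div)
    have g_mem: "coeff g j \<in> P" for j
    proof (rule less.hyps[of g "S - {c}"])
      show "degree g < degree f" using False deg by simp
      show "degree g < card (S - {c})" using False deg less.prems(1) c fin by simp
      show "poly g x \<in> P" if x: "x \<in> S - {c}" for x
      proof -
        have "poly f x = (x - c) * poly g x + poly f c"
          by (subst f_eq) (simp add: algebra_simps)
        then have "(x - c) * poly g x = poly f x + - poly f c" by simp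
        also have "\<dots> \<in> P"
          using x c less.prems(2) by (intro add_mem uminus_mem) auto
        finally have "(x - c) * poly g x \<in> P" .
        moreover have "x - c \<notin> P"
          using less.prems(3)[of x c] x c by (auto simp: ideal_cong_def)
        ultimately show ?thesis using prime by blast
      qed
      show "x = y" if "x \<in> S - {c}" "y \<in> S - {c}" "x \<approx> y" for x y
        using less.prems(3) that by blast
    qed
    have "coeff f i = (case i of 0 \<Rightarrow> 0 | Suc j \<Rightarrow> coeff g j) + - c * coeff g i + coeff [:poly f c:] i"
      by (subst f_eq) (simp add: coeff_pCons split: nat.splits)
    also have "\<dots> \<in> P"
      using g_mem less.prems(2)[OF c] zero_mem
      by (intro add_mem mult_mem) (auto split: nat.splits simp: coeff_pCons)
    finally show ?thesis .
  qed
qed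

end

text \<open>A maximal proper ideal \<open>M\<close> above \<open>J\<close> is prime: if \<open>y\<close> is not in \<open>M\<close>, then \<open>M\<close> and \<open>y\<close>
  together generate 1, say \<open>1 = m + c y\<close>, so \<open>x y \<in> M\<close> forces \<open>x = x m + c x y \<in> M\<close>.\<close>

lemma prime_ideal_above:
  fixes J :: "'a::comm_ring_1 set"
  assumes J: "ring_ideal J" and one: "1 \<notin> J"
  obtains M where "prime_ideal M" "J \<subseteq> M"
proof -
  define A where "A = {I. ring_ideal I \<and> 1 \<notin> I \<and> J \<subseteq> I}"
  have "\<exists>M\<in>A. \<forall>X\<in>A. M \<subseteq> X \<longrightarrow> X = M"
  proof (rule subset_Zorn_nonempty)
    show "A \<noteq> {}" using J one by (auto simp: A_def)
  next
    fix \<C> assume ne: "\<C> \<noteq> {}" and ch: "subset.chain A \<C>"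
    have ids: "ring_ideal I" "1 \<notin> I" "J \<subseteq> I" if "I \<in> \<C>" for I
      using ch that by (auto simp: subset.chain_def A_def)
    have "ring_ideal (\<Union>\<C>)"
    proof
      show "0 \<in> \<Union>\<C>" using ne ids(1) ring_ideal.zero_mem by blast
      show "c * x \<in> \<Union>\<C>" if "x \<in> \<Union>\<C>" for c x
        using that ids(1) ring_ideal.mult_mem by blast
      fix x y assume "x \<in> \<Union>\<C>" "y \<in> \<Union>\<C>"
      then obtain I I' where I: "I \<in> \<C>" "x \<in> I" "I' \<in> \<C>" "y \<in> I'" by blast
      then have "I \<subseteq> I' \<or> I' \<subseteq> I" using ch by (auto simp: subset.chain_def)
      then show "x + y \<in> \<Union>\<C>"
        using I ids(1) ring_ideal.add_mem by blast
    qed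
    moreover have "1 \<notin> \<Union>\<C>" "J \<subseteq> \<Union>\<C>" using ne ids by blast+
    ultimately show "\<Union>\<C> \<in> A" by (simp add: A_def)
  qed
  then obtain M where M: "M \<in> A" and max: "\<And>X. X \<in> A \<Longrightarrow> M \<subseteq> X \<Longrightarrow> X = M"
    by blast
  interpret ring_ideal M using M by (simp add: A_def)
  have "prime_ideal M"
  proof
    show "1 \<notin> M" using M by (simp add: A_def)
    fix x y assume xy: "x * y \<in> M"
    show "x \<in> M \<or> y \<in> M"
    proof (rule disjCI)
      assume y: "y \<notin> M"
      define N where "N = {m + c * y | m c. m \<in> M}"
      have "ring_ideal N"
      proof
        show "0 \<in> N" unfolding N_def using zero_mem by (auto intro!: exI[of _ 0])
        fix u v c assume u: "u \<in> N"
        then obtain m d where m: "u = m + d * y" "m \<in> M" by (auto simp: N_def)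
        have "c * u = c * m + (c * d) * y" by (simp add: m algebra_simps)
        then show "c * u \<in> N" unfolding N_def using mult_mem m by blast
        assume "v \<in> N"
        then obtain m' d' where m': "v = m' + d' * y" "m' \<in> M" by (auto simp: N_def)
        have "u + v = (m + m') + (d + d') * y" by (simp add: m m' algebra_simps)
        then show "u + v \<in> N" unfolding N_def using add_mem m m' by blast
      qed
      moreover have MN: "M \<subseteq> N"
      proof
        fix m assume "m \<in> M"
        moreover have "m = m + 0 * y" by simp
        ultimately show "m \<in> N" unfolding N_def by blast
      qed
      moreover have "y = 0 + 1 * y" by simp
      then have "y \<in> N" unfolding N_def using zero_mem by blast
      ultimately have N: "ring_ideal N" "M \<subseteq> N" "y \<in> N" by blast+
      have "1 \<in> N"
      proof (rule ccontr)
        assume "1 \<notin> N"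
        then have "N \<in> A" using N(1,2) M unfolding A_def by blast
        then show False using max N(2,3) y by blast
      qed
      then obtain m c where mc: "1 = m + c * y" "m \<in> M" by (auto simp: N_def)
      have "x = x * (m + c * y)" using mc by simp
      also have "\<dots> = x * m + c * (x * y)" by (simp add: algebra_simps)
      also have "\<dots> \<in> M" by (intro add_mem mult_mem[OF mc(2)] mult_mem[OF xy])
      finally show "x \<in> M" .
    qed
  qed
  then show ?thesis using that M by (auto simp: A_def)
qed

section \<open>The Frobenius map modulo a prime ideal\<close>

locale prime_ideal_char = prime_ideal +
  fixes p :: nat
  assumes prime_p: "prime p" and p_mem: "of_nat p \<in> P"
begin

lemma frobenius_add: "(u + v) ^ p \<approx> u ^ p + v ^ p"
proof -
  have p: "p > 0" using prime_p prime_gt_0_nat by blast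
  have "(u + v) ^ p = (\<Sum>k\<le>p. of_nat (p choose k) * u ^ k * v ^ (p - k))"
    by (rule binomial_ring)
  also have "{..p} = insert 0 (insert p {0<..<p})" using p by auto
  also have "(\<Sum>k\<in>\<dots>. of_nat (p choose k) * u ^ k * v ^ (p - k)) =
      u ^ p + v ^ p + (\<Sum>k\<in>{0<..<p}. of_nat (p choose k) * u ^ k * v ^ (p - k))"
    using p by (simp add: algebra_simps)
  finally have "(u + v) ^ p - (u ^ p + v ^ p)
      = (\<Sum>k\<in>{0<..<p}. of_nat (p choose k) * u ^ k * v ^ (p - k))" by simp
  also have "\<dots> \<in> P"
  proof (rule sum_mem)
    fix k assume "k \<in> {0<..<p}"
    then have "p dvd p choose k"
      using prime_p by (intro dvd_choose_prime) auto
    then obtain c where "p choose k = p * c" by blast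
    then show "of_nat (p choose k) * u ^ k * v ^ (p - k) \<in> P"
      using p_mem by (simp add: mult.assoc mult_mem')
  qed
  finally show ?thesis by (simp add: ideal_cong_def)
qed

lemma frobenius_inj:
  assumes "u ^ p \<approx> v ^ p"
  shows "u \<approx> v"
proof -
  have "(u - v) ^ p + v ^ p \<approx> (u - v + v) ^ p"
    by (rule ideal_cong_sym, rule frobenius_add)
  also have "(u - v + v) ^ p = u ^ p" by simp
  also note assms
  finally have "(u - v) ^ p \<in> P" by (simp add: ideal_cong_def)
  then show ?thesis unfolding ideal_cong_def by (rule power_memD)
qed

lemma of_int_mem_iff: "of_int c \<in> P \<longleftrightarrow> int p dvd c"
proof
  assume "int p dvd c"
  then obtain k where "c = int p * k" by blast
  then show "of_int c \<in> P" using p_mem by (simp add: mult_mem')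
next
  assume c: "of_int c \<in> P"
  show "int p dvd c"
  proof (rule ccontr)
    assume "\<not> int p dvd c"
    then have "coprime (int p) c" using prime_p by (simp add: prime_imp_coprime)
    then obtain u v where "u * int p + v * c = 1"
      using bezout_int[of "int p" c] by auto
    then have "of_int u * of_nat p + of_int v * of_int c = (1::'a)"
      by (metis of_int_1 of_int_add of_int_mult of_int_of_nat_eq)
    moreover have "of_int u * of_nat p + of_int v * of_int c \<in> P"
      using c p_mem by (intro add_mem mult_mem)
    ultimately show False using one_notin by simp
  qed
qed

lemma of_int_cong_iff: "of_int c \<approx> of_int d \<longleftrightarrow> [c = d] (mod int p)"
  using of_int_mem_iff[of "c - d"] by (simp add: ideal_cong_def cong_iff_dvd_diff)

text \<open>Fermat's little theorem is the additivity of the Frobenius map, applied to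
  \<open>1 + \<dots> + 1\<close>.\<close>

lemma of_int_power_cong: "of_int c ^ p \<approx> of_int c"
proof -
  have p: "p > 0" using prime_p prime_gt_0_nat by blast
  have nat: "of_nat k ^ p \<approx> of_nat k" for k
  proof (induction k)
    case 0
    show ?case using p by (simp add: power_0_left)
  next
    case (Suc k)
    have "of_nat (Suc k) ^ p \<approx> 1 ^ p + of_nat k ^ p"
      using frobenius_add[of 1 "of_nat k"] by simp
    also have "1 ^ p + of_nat k ^ p \<approx> 1 + of_nat k"
      using Suc.IH by (intro ideal_cong_add) simp_all
    finally show ?case by simp
  qed
  define k where "k = nat (c mod int p)"
  have "[c = int k] (mod int p)" using p by (simp add: k_def cong_def)
  then have c: "of_int c \<approx> of_nat k"
    by (metis of_int_cong_iff of_int_of_nat_eq)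
  have "of_int c ^ p \<approx> of_nat k ^ p" by (rule ideal_cong_power[OF c])
  also note nat
  also note ideal_cong_sym[OF c]
  finally show ?thesis .
qed

end

section \<open>Adjoining an \<open>r\<close>-th root of \<open>a\<close>\<close>

text \<open>\<open>P\<close> is to be thought of as the kernel of the map from the integer polynomials onto the field
  generated over the prime field by an \<open>r\<close>-th root of \<open>a\<close>. By Euler's criterion for \<open>r\<close>-th powers,
  the last assumption says that \<open>a\<close> has no \<open>r\<close>-th root in the prime field itself.\<close>

locale radical_extension = prime_ideal_char P p
  for P :: "int poly set" and p :: nat +
  fixes r :: nat and a :: int
  assumes prime_r: "prime r" and r_dvd: "r dvd p - 1"
    and root: "[:0, 1:] ^ r \<approx> [:a:]"
    and a_unit: "\<not> int p dvd a"
    and not_power: "\<not> [a ^ ((p - 1) div r) = 1] (mod int p)"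
begin

text \<open>The conjugates of \<open>x\<close> are its products with powers of \<open>z\<close>, as the Frobenius map multiplies \<open>x\<close>
  by \<open>z\<close>.\<close>

definition z :: int where "z = a ^ ((p - 1) div r)"

lemma r_pos: "r > 0"
  using prime_r prime_gt_0_nat by blast

lemma p_pos: "p > 0"
  using prime_p prime_gt_0_nat by blast

lemma const_mem_iff: "[:c:] \<in> P \<longleftrightarrow> int p dvd c"
  using of_int_mem_iff[of c] by (simp add: of_int_poly)

lemma coprime_a: "coprime a (int p)"
proof -
  have "coprime (int p) a" using a_unit prime_p by (simp add: prime_imp_coprime)
  then show ?thesis by (simp add: coprime_commute)
qed

lemma z_power_r: "[z ^ r = 1] (mod int p)"
proof -
  have "z ^ r = a ^ (p - 1)"
    using r_dvd by (simp add: z_def flip: power_mult)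
  moreover have "[a * a ^ (p - 1) = a * 1] (mod int p)"
    using of_int_power_cong[of a] p_pos
    by (simp add: of_int_cong_iff flip: of_int_power power_Suc)
  ultimately show ?thesis using coprime_a by (simp only: cong_mult_lcancel)
qed

lemma coprime_z: "coprime z (int p)"
  using coprime_a by (simp add: z_def)

text \<open>Since \<open>r\<close> is prime and \<open>z\<close> is not 1, the order of \<open>z\<close> modulo \<open>p\<close> is exactly \<open>r\<close>.\<close>

lemma z_power_inj:
  assumes "[z ^ i = z ^ j] (mod int p)" "i < r" "j < r"
  shows "i = j"
  using assms
proof (induction i j rule: linorder_wlog)
  case (sym i j)
  then show ?case by (simp add: cong_sym_eq)
next
  case (le i j)
  show ?case
  proof (rule ccontr)
    assume ne: "i \<noteq> j"
    define d where "d = j - i"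
    have d: "0 < d" "d < r" "j = i + d" using le ne by (auto simp: d_def)
    have "[z ^ i * 1 = z ^ i * z ^ d] (mod int p)"
      using le(2) by (simp add: d(3) power_add)
    then have zd: "[1 = z ^ d] (mod int p)"
      using coprime_z by (subst (asm) cong_mult_lcancel) simp_all
    have "coprime d r"
      using d prime_r by (meson coprime_commute nat_dvd_not_less prime_imp_coprime)
    then obtain u v where uv: "d * u = r * v + 1"
      using bezout_nat[of d r] d by auto
    have "[z ^ (d * u) = 1] (mod int p)"
      using cong_pow[OF zd, of u] by (simp add: power_mult cong_sym_eq)
    moreover have "[z ^ (r * v + 1) = 1 * z] (mod int p)"
      using cong_mult[OF cong_pow[OF z_power_r, of v] cong_refl[of z]]
      by (simp add: power_add power_mult mult.commute)
    ultimately have "[z = 1] (mod int p)"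
      using uv by (metis cong_sym cong_trans mult_1)
    then show False using not_power by (simp add: z_def)
  qed
qed

lemma linear_cong: "[c = d] (mod int p) \<Longrightarrow> [:1, c:] \<approx> [:1, d:]"
proof -
  assume "[c = d] (mod int p)"
  then have "[:0, 1:] * [:c - d:] \<in> P"
    by (intro mult_mem) (simp add: const_mem_iff cong_iff_dvd_diff)
  then show ?thesis by (simp add: ideal_cong_def)
qed

lemma x_power_p: "[:0, 1:] ^ p \<approx> [:z:] * [:0, 1:]"
proof -
  have "[:0, 1:] ^ p = [:0, 1::int:] * ([:0, 1:] ^ r) ^ ((p - 1) div r)"
    using r_dvd p_pos by (simp flip: power_mult power_Suc)
  also have "\<dots> \<approx> [:0, 1:] * [:a:] ^ ((p - 1) div r)"
    by (intro ideal_cong_mult ideal_cong_power root ideal_cong_refl)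
  finally show ?thesis by (simp add: z_def poly_const_pow)
qed

lemma x_notin: "[:0, 1:] \<notin> P"
proof
  assume x: "[:0, 1:] \<in> P"
  have "[:0, 1:] ^ r = [:0, 1::int:] * [:0, 1:] ^ (r - 1)"
    using r_pos by (simp flip: power_Suc)
  then have "[:0, 1:] ^ r \<in> P" using mult_mem'[OF x] by simp
  then have "[:a:] \<in> P" using root ideal_cong_mem ideal_cong_sym by blast
  then show False using a_unit const_mem_iff by blast
qed

lemma linear_power_p: "[:1, c:] ^ p \<approx> [:1, c * z:]"
proof -
  have "[:1, c:] ^ p = (1 + of_int c * [:0, 1:]) ^ p"
    by (simp add: of_int_poly one_pCons)
  also have "\<dots> \<approx> 1 ^ p + (of_int c * [:0, 1:]) ^ p" by (rule frobenius_add)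
  also have "\<dots> = 1 + of_int c ^ p * [:0, 1:] ^ p" by (simp only: power_mult_distrib power_one)
  also have "\<dots> \<approx> 1 + of_int c * ([:z:] * [:0, 1:])"
    by (intro ideal_cong_add ideal_cong_mult of_int_power_cong x_power_p ideal_cong_refl)
  also have "\<dots> = [:1, c * z:]" by (simp add: of_int_poly one_pCons)
  finally show ?thesis .
qed

lemma pcompose_cong: "e \<approx> e' \<Longrightarrow> pcompose D e \<approx> pcompose D e'"
  by (induction D) (auto simp: pcompose_pCons intro!: ideal_cong_add ideal_cong_mult)

text \<open>Evaluating \<open>D\<close> at an element is composing with it, and the Frobenius map fixes the integer
  coefficients of \<open>D\<close>. So it carries roots of \<open>D\<close> to roots.\<close>

lemma pcompose_power_p: "pcompose D e ^ p \<approx> pcompose D (e ^ p)"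
proof (induction D)
  case 0
  show ?case using p_pos by (simp add: power_0_left)
next
  case (pCons c D)
  have "([:c:] + e * pcompose D e) ^ p \<approx> [:c:] ^ p + (e * pcompose D e) ^ p"
    by (rule frobenius_add)
  also have "\<dots> = of_int c ^ p + e ^ p * pcompose D e ^ p"
    by (simp add: of_int_poly power_mult_distrib)
  also have "\<dots> \<approx> of_int c + e ^ p * pcompose D (e ^ p)"
    by (intro ideal_cong_add ideal_cong_mult of_int_power_cong pCons.IH ideal_cong_refl)
  finally show ?case by (simp add: pcompose_pCons of_int_poly)
qed

text \<open>The class of \<open>x\<close> has degree \<open>r\<close> over the prime field: a polynomial that vanishes at it
  also vanishes at its conjugates \<open>z ^ j * x\<close> for \<open>j < r\<close>, which are distinct because \<open>z\<close>
  has order \<open>r\<close>. This amounts to the irreducibility of \<open>x ^ r - a\<close> modulo \<open>p\<close>.\<close>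

lemma dvd_coeff_of_small_degree:
  assumes D: "D \<in> P" "degree D < r"
  shows "int p dvd coeff D i"
proof -
  define e where "e = (\<lambda>j. [:z ^ j:] * [:0, 1::int:])"
  have De: "pcompose D (e j) \<in> P" for j
  proof (induction j)
    case 0
    then show ?case using D by (simp add: e_def)
  next
    case (Suc j)
    have "e j ^ p = of_int (z ^ j) ^ p * [:0, 1:] ^ p"
      unfolding e_def power_mult_distrib by (simp add: of_int_poly)
    also have "\<dots> \<approx> of_int (z ^ j) * ([:z:] * [:0, 1:])"
      by (intro ideal_cong_mult of_int_power_cong x_power_p)
    also have "\<dots> = e (Suc j)" by (simp add: of_int_poly e_def mult.commute)
    finally have "pcompose D (e j ^ p) \<approx> pcompose D (e (Suc j))" by (rule pcompose_cong)
    moreover have "pcompose D (e j) ^ p = pcompose D (e j) * pcompose D (e j) ^ (p - 1)"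
      using p_pos by (simp flip: power_Suc)
    then have "pcompose D (e j) ^ p \<in> P" using mult_mem'[OF Suc.IH] by simp
    then have "pcompose D (e j ^ p) \<in> P"
      using pcompose_power_p ideal_cong_mem ideal_cong_sym by blast
    ultimately show ?case using ideal_cong_mem ideal_cong_sym by blast
  qed
  have inj: "i = j" if ij: "i < r" "j < r" "e i \<approx> e j" for i j
  proof -
    have "[:z ^ i - z ^ j:] * [:0, 1:] \<in> P"
      using ij(3) by (simp add: e_def ideal_cong_def)
    then have "[:z ^ i - z ^ j:] \<in> P" using prime x_notin by blast
    then show ?thesis using ij z_power_inj by (simp add: const_mem_iff cong_iff_dvd_diff)
  qed
  have "coeff (map_poly (\<lambda>c. [:c:]) D) i \<in> P"
  proof (rule coeff_mem_of_many_roots)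
    have "inj_on e {..<r}" using inj by (auto intro!: inj_onI)
    then have "card (e ` {..<r}) = r" by (simp add: card_image)
    then show "degree (map_poly (\<lambda>c. [:c:]) D) < card (e ` {..<r})"
      using D(2) map_poly_degree_leq[of "\<lambda>c. [:c:]" D] by simp
    show "poly (map_poly (\<lambda>c. [:c:]) D) x \<in> P" if "x \<in> e ` {..<r}" for x
      using De that by (auto simp flip: pcompose_altdef)
    show "x = y" if "x \<in> e ` {..<r}" "y \<in> e ` {..<r}" "x \<approx> y" for x y
      using that inj by auto
  qed
  then show ?thesis by (simp add: coeff_map_poly const_mem_iff)
qed

text \<open>For proper subsets of \<open>{..<r}\<close> these products have degree below \<open>r\<close>, so that different ones
  stay different modulo \<open>P\<close>. The product over all of \<open>{..<r}\<close> is congruent to a constant.\<close>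

definition linear_product :: "nat set \<Rightarrow> int poly" where
  "linear_product T = (\<Prod>k\<in>T. [:1, z ^ k:])"

lemma degree_linear_product:
  assumes "T \<subset> {..<r}"
  shows "degree (linear_product T) < r"
proof -
  have "finite T" using assms finite_subset by blast
  have "degree (linear_product T) \<le> (\<Sum>k\<in>T. degree [:1, z ^ k:])"
    unfolding linear_product_def
    using degree_prod_sum_le[OF \<open>finite T\<close>, of "\<lambda>k. [:1, z ^ k:]"] by (simp only: o_def)
  also have "\<dots> \<le> (\<Sum>k\<in>T. 1)" by (intro sum_mono) simp
  also have "\<dots> < r" using psubset_card_mono[OF _ assms] by simp
  finally show ?thesis .
qed

lemma dvd_poly_of_small_degree:
  assumes "D \<in> P" "degree D < r"
  shows "int p dvd poly D t"
  unfolding poly_altdef by (intro dvd_sum dvd_mult2 dvd_coeff_of_small_degree assms)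

lemma linear_product_notin:
  assumes "T \<subset> {..<r}"
  shows "linear_product T \<notin> P"
proof
  assume "linear_product T \<in> P"
  then have "int p dvd poly (linear_product T) 0"
    by (intro dvd_poly_of_small_degree degree_linear_product assms)
  then show False
    using prime_p by (simp add: linear_product_def poly_prod not_prime_1)
qed

text \<open>The roots of \<open>linear_product T\<close> modulo \<open>p\<close> are the elements \<open>- z ^ (r - k)\<close> for \<open>k \<in> T\<close>, so they
  determine \<open>T\<close>.\<close>

lemma linear_product_subset:
  assumes T: "T \<subset> {..<r}" and T': "T' \<subset> {..<r}"
    and cong: "linear_product T \<approx> linear_product T'"
  shows "T \<subseteq> T'"
proof
  fix k assume k: "k \<in> T"
  have kr: "k < r" using k T by auto
  have fin: "finite T" "finite T'" using T T' finite_subset by blast+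
  define t where "t = - (z ^ (r - k))"
  have "int p dvd poly (linear_product T - linear_product T') t"
  proof (rule dvd_poly_of_small_degree)
    show "linear_product T - linear_product T' \<in> P" using cong by (simp add: ideal_cong_def)
    show "degree (linear_product T - linear_product T') < r"
      using degree_linear_product T T' by (intro degree_diff_less) auto
  qed
  moreover have "int p dvd poly (linear_product T) t"
  proof -
    have "1 + z ^ k * t = 1 - z ^ r"
      using kr by (simp add: t_def flip: power_add)
    then have "int p dvd 1 + z ^ k * t"
      using z_power_r by (metis cong_iff_dvd_diff cong_sym_eq)
    moreover have "1 + z ^ k * t dvd poly (linear_product T) t"
      unfolding linear_product_def poly_prod
      using dvd_prodI[OF fin(1) k, of "\<lambda>k. poly [:1, z ^ k:] t"] by (simp add: mult.commute)
    ultimately show ?thesis by (rule dvd_trans)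
  qed
  ultimately have "int p dvd poly (linear_product T') t"
    by (simp add: dvd_diff_right_iff)
  then obtain l where l: "l \<in> T'" "int p dvd 1 + t * z ^ l"
    unfolding linear_product_def poly_prod
    using prime_p fin by (auto simp: prime_dvd_prod_iff)
  have "int p dvd z ^ k * (1 + t * z ^ l)" using l by simp
  also have "z ^ k * (1 + t * z ^ l) = z ^ k - z ^ r * z ^ l"
    using kr by (simp add: t_def algebra_simps flip: power_add)
  finally have "[z ^ k = z ^ r * z ^ l] (mod int p)" by (simp add: cong_iff_dvd_diff)
  moreover have "[z ^ r * z ^ l = 1 * z ^ l] (mod int p)"
    by (intro cong_scalar_right z_power_r)
  ultimately have "[z ^ k = z ^ l] (mod int p)" by (metis cong_trans mult_1)
  then have "k = l" using z_power_inj kr l T' by auto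
  then show "k \<in> T'" using l by simp
qed

lemma linear_product_inj:
  assumes "T \<subset> {..<r}" "T' \<subset> {..<r}" "linear_product T \<approx> linear_product T'"
  shows "T = T'"
  using assms linear_product_subset ideal_cong_sym by blast

end

text \<open>Dividing \<open>u\<close> by the monic \<open>g\<close> shows that 1 would be a multiple of \<open>p\<close> of degree below that of
  \<open>g\<close> plus a multiple of \<open>g\<close>. Comparing degrees, the latter is 0, and 1 is a multiple of \<open>p\<close>.\<close>

lemma proper_ideal_const_monic:
  fixes g :: "int poly"
  assumes p: "p > 1" and monic: "lead_coeff g = 1" and deg: "degree g > 0"
  shows "1 \<noteq> u * [:int p:] + v * g"
proof
  assume eq: "1 = u * [:int p:] + v * g"
  have g0: "g \<noteq> 0" using deg by auto
  \<comment> \<open>pseudo-division by a monic polynomial is division with remainder\<close>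
  obtain k t where kt: "pseudo_divmod u g = (k, t)" by fastforce
  have u: "u = g * k + t" using pseudo_divmod(1)[OF g0 kt] monic by simp
  have t: "degree t < degree g" using pseudo_divmod(2)[OF g0 kt] deg by auto
  have e: "1 - smult (int p) t = (v + smult (int p) k) * g"
    by (subst eq) (simp add: u algebra_simps smult_add_right)
  have "degree (1 - smult (int p) t) < degree g"
    using t deg by (intro degree_diff_less) auto
  then have "v + smult (int p) k = 0"
    using e degree_mult_eq[of "v + smult (int p) k" g] g0 by auto
  then have "1 - smult (int p) t = 0" using e by simp
  then have "coeff (1 - smult (int p) t) 0 = 0" by simp
  then have "int p * coeff t 0 = 1" by simp
  then have "int p dvd 1" by (metis dvd_triv_left)
  then show False using p by simp
qed

text \<open>Any prime ideal above the proper ideal generated by \<open>p\<close> and \<open>x ^ r - a\<close> will do.\<close>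

lemma exists_radical_extension:
  fixes p r :: nat and a :: int
  assumes p: "prime p" and r: "prime r" "r dvd p - 1" and a: "\<not> int p dvd a"
    and not_power: "\<not> [a ^ ((p - 1) div r) = 1] (mod int p)"
  obtains P where "radical_extension P p r a"
proof -
  define g :: "int poly" where "g = [:0, 1:] ^ r - [:a:]"
  have r0: "r > 0" using r(1) prime_gt_0_nat by blast
  have g_monom: "g = monom 1 r - [:a:]" by (simp add: g_def monom_altdef)
  then have coeff: "coeff g r = 1" using r0 by (simp add: coeff_pCons split: nat.splits)
  have "degree g \<le> r"
    unfolding g_monom by (intro degree_diff_le) (simp_all add: degree_monom_le)
  then have deg: "degree g = r" using coeff le_degree[of g r] by simp
  define J where "J = {u * [:int p:] + v * g | u v. True}"
  have "ring_ideal J"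
  proof
    have "0 = 0 * [:int p:] + 0 * g" by simp
    then show "0 \<in> J" unfolding J_def by blast
    fix x y c assume "x \<in> J"
    then obtain u v where x: "x = u * [:int p:] + v * g" by (auto simp: J_def)
    have "c * x = (c * u) * [:int p:] + (c * v) * g" by (simp only: x algebra_simps)
    then show "c * x \<in> J" unfolding J_def by blast
    assume "y \<in> J"
    then obtain u' v' where y: "y = u' * [:int p:] + v' * g" by (auto simp: J_def)
    have "x + y = (u + u') * [:int p:] + (v + v') * g" by (simp only: x y algebra_simps)
    then show "x + y \<in> J" unfolding J_def by blast
  qed
  moreover have "1 \<notin> J"
    using proper_ideal_const_monic[of p g] prime_gt_1_nat[OF p] coeff deg r0
    by (auto simp: J_def)
  ultimately obtain M where M: "prime_ideal M" "J \<subseteq> M" by (rule prime_ideal_above)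
  interpret prime_ideal M by (rule M(1))
  have "[:int p:] = 1 * [:int p:] + 0 * g" "g = 0 * [:int p:] + 1 * g" by simp_all
  then have "[:int p:] \<in> M" "g \<in> M" using M(2) unfolding J_def by blast+
  then have "radical_extension M p r a"
    by unfold_locales (use assms in \<open>simp_all add: g_def ideal_cong_def of_nat_poly\<close>)
  then show ?thesis by (rule that)
qed

section \<open>Two exponents with the same action\<close>

lemma mult_root_of_unity:
  fixes c d m :: int
  assumes "[c ^ k = 1] (mod m)" "[d ^ k = 1] (mod m)"
  shows "[(c * d) ^ k = 1] (mod m)"
  using cong_mult[OF assms] by (simp add: power_mult_distrib)

lemma power_root_of_unity:
  fixes c m :: int
  assumes "[c ^ k = 1] (mod m)"
  shows "[(c ^ i) ^ k = 1] (mod m)"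
  using cong_pow[OF assms, of i] by (simp add: mult.commute flip: power_mult)

lemma pcompose_power: "pcompose (f ^ n) e = pcompose f e ^ n"
  for f e :: "'a::comm_ring_1 poly"
  by (induction n) (simp_all add: pcompose_1 pcompose_mult)

context radical_extension
begin

lemma linear_power_iterate:
  assumes action: "\<And>c. [c ^ r = 1] (mod int p) \<Longrightarrow> [:1, c:] ^ m \<approx> [:1, c * u:]"
    and u: "[u ^ r = 1] (mod int p)" and c: "[c ^ r = 1] (mod int p)"
  shows "[:1, c:] ^ (m ^ i) \<approx> [:1, c * u ^ i:]"
proof (induction i)
  case 0
  show ?case by simp
next
  case (Suc i)
  have "[:1, c:] ^ (m ^ Suc i) = ([:1, c:] ^ (m ^ i)) ^ m"
    by (simp add: mult.commute flip: power_mult)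
  also have "\<dots> \<approx> [:1, c * u ^ i:] ^ m" by (rule ideal_cong_power[OF Suc.IH])
  also have "\<dots> \<approx> [:1, c * u ^ i * u:]"
    by (intro action mult_root_of_unity power_root_of_unity u c)
  also have "c * u ^ i * u = c * u ^ Suc i" by simp
  finally show ?case .
qed

text \<open>For an \<open>r\<close>-th root of unity \<open>c\<close>, substituting \<open>c x\<close> for \<open>x\<close> preserves the ideal generated by \<open>p\<close>
  and \<open>x ^ r - a\<close>, so the one given congruence yields one for every conjugate of \<open>1 + x\<close>.\<close>

lemma linear_power_n:
  assumes eq: "(1 + [:0, 1:]) ^ n - (1 + [:0, 1:] ^ n) = u * [:int n:] + v * ([:0, 1:] ^ r - [:a:])"
    and n: "p dvd n" "n > 0" "r dvd n - 1"
    and c: "[c ^ r = 1] (mod int p)"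
  shows "[:1, c:] ^ n \<approx> [:1, c * a ^ ((n - 1) div r):]"
proof -
  define e where "e = [:0, c:]"
  define k where "k = (n - 1) div r"
  have e_eq: "e = [:c:] * [:0, 1:]" by (simp add: e_def)
  have n_eq: "n = Suc (r * k)" using n by (simp add: k_def)
  have const_cong: "[:b:] \<approx> [:d:]" if "[b = d] (mod int p)" for b d
    using that by (simp add: ideal_cong_def const_mem_iff cong_iff_dvd_diff)
  have "e ^ r = [:c ^ r:] * [:0, 1:] ^ r"
    unfolding e_eq power_mult_distrib by (simp add: poly_const_pow)
  also have "\<dots> \<approx> [:1:] * [:a:]"
    by (intro ideal_cong_mult const_cong c root)
  finally have e_r: "e ^ r - [:a:] \<in> P" by (simp add: ideal_cong_def)
  have "(1 + e) ^ n - (1 + e ^ n)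
      = pcompose ((1 + [:0, 1:]) ^ n - (1 + [:0, 1:] ^ n)) e"
    by (simp add: pcompose_diff pcompose_add pcompose_power pcompose_1 pcompose_pCons)
  also have "\<dots> = pcompose u e * [:int n:] + pcompose v e * (e ^ r - [:a:])"
    unfolding eq by (simp add: pcompose_diff pcompose_add pcompose_mult pcompose_power pcompose_pCons
        pcompose_smult)
  also have "\<dots> \<in> P"
    using n(1) by (intro add_mem mult_mem e_r) (simp add: const_mem_iff)
  finally have "(1 + e) ^ n \<approx> 1 + e ^ n" by (simp add: ideal_cong_def)
  moreover have "e ^ n \<approx> [:c * a ^ k:] * [:0, 1:]"
  proof -
    have "e ^ n = [:c * (c ^ r) ^ k:] * [:0, 1:] * ([:0, 1:] ^ r) ^ k"
      unfolding e_eq power_mult_distrib by (simp add: poly_const_pow n_eq mult.commute flip: power_mult)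
    also have "\<dots> \<approx> [:c * 1 ^ k:] * [:0, 1:] * [:a:] ^ k"
      by (intro ideal_cong_mult ideal_cong_power root const_cong cong_scalar_left cong_pow c
          ideal_cong_refl)
    finally show ?thesis by (simp add: poly_const_pow mult.commute)
  qed
  ultimately have "(1 + e) ^ n \<approx> 1 + [:c * a ^ k:] * [:0, 1:]"
    using ideal_cong_add[OF ideal_cong_refl[of 1]] ideal_cong_trans by blast
  then show ?thesis by (simp add: e_def k_def one_pCons)
qed

text \<open>\<open>X ^ r - 1\<close> has at most \<open>r\<close> roots, which makes the pigeonhole principle applicable.\<close>

lemma too_many_roots_of_unity:
  assumes "finite I" "card I > r"
    and "\<And>i. i \<in> I \<Longrightarrow> [f i ^ r = 1] (mod int p)"
  obtains i j where "i \<in> I" "j \<in> I" "i \<noteq> j" "[f i = f j] (mod int p)"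
proof (rule ccontr)
  assume *: "\<not> thesis"
  note found = that
  have inj: "i = j" if "i \<in> I" "j \<in> I" "[:f i:] \<approx> [:f j:]" for i j
  proof -
    have "[f i = f j] (mod int p)"
      using that(3) by (simp add: ideal_cong_def const_mem_iff cong_iff_dvd_diff)
    then show ?thesis using that(1,2) found[of i j] * by blast
  qed
  define S where "S = (\<lambda>i. [:f i:]) ` I"
  have "inj_on (\<lambda>i. [:f i:]) I" using inj by (intro inj_onI) simp
  then have card: "card S = card I" by (simp add: S_def card_image)
  have "coeff (monom 1 r - 1 :: int poly poly) r \<in> P"
  proof (rule coeff_mem_of_many_roots)
    have "degree (monom 1 r - 1 :: int poly poly) \<le> r"
      by (intro degree_diff_le) (simp_all add: degree_monom_le)
    then show "degree (monom 1 r - 1 :: int poly poly) < card S"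
      using card assms(2) by simp
    show "poly (monom 1 r - 1) x \<in> P" if x: "x \<in> S" for x
    proof -
      obtain i where i: "i \<in> I" "x = [:f i:]" using x by (auto simp: S_def)
      have "poly (monom 1 r - 1) x = [:f i ^ r - 1:]"
        by (simp add: i poly_monom poly_const_pow one_pCons)
      then show ?thesis using assms(3)[OF i(1)] by (simp add: const_mem_iff cong_iff_dvd_diff)
    qed
    show "x = y" if "x \<in> S" "y \<in> S" "x \<approx> y" for x y
      using that inj by (auto simp: S_def)
  qed
  then show False using r_pos one_notin by simp
qed

text \<open>The products of the linear polynomials over proper subsets of their index set are
  \<open>2 ^ r - 1\<close> distinct nonzero classes, and all of them, as well as 0, are roots of
  \<open>X ^ m - X ^ m'\<close>.\<close>

lemma equal_action_imp_equal:
  assumes m: "0 < m" "m < 2 ^ r" and m': "0 < m'" "m' < 2 ^ r"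
    and action: "\<And>c. [c ^ r = 1] (mod int p) \<Longrightarrow> [:1, c:] ^ m \<approx> [:1, c:] ^ m'"
  shows "m = m'"
proof (rule ccontr)
  assume ne: "m \<noteq> m'"
  \<comment> \<open>The root 0 makes up for the excluded set \<open>{..<r}\<close>: exactly \<open>2 ^ r\<close> roots are needed.\<close>
  define A where "A = {T. T \<subset> {..<r}}"
  define S where "S = insert 0 (linear_product ` A)"
  define f :: "int poly poly" where "f = monom 1 m - monom 1 m'"
  have A: "A = Pow {..<r} - {{..<r}}" unfolding A_def by blast
  have "finite A" "card A = 2 ^ r - 1"
    unfolding A by (simp_all add: card_Diff_singleton card_Pow)
  have notin: "linear_product T \<notin> P" if "T \<in> A" for T
    using that linear_product_notin by (simp add: A_def)
  have inj: "T = T'" if "T \<in> A" "T' \<in> A" "linear_product T \<approx> linear_product T'" for T T'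
    using that linear_product_inj by (simp add: A_def)
  have "inj_on linear_product A"
    by (rule inj_onI, rule inj) simp_all
  then have "card (linear_product ` A) = 2 ^ r - 1"
    using \<open>card A = 2 ^ r - 1\<close> by (simp add: card_image)
  moreover have "0 \<notin> linear_product ` A"
    using notin zero_mem by (metis imageE)
  ultimately have card: "card S = 2 ^ r"
    using \<open>finite A\<close> by (simp add: S_def)
  have "coeff f m \<in> P"
  proof (rule coeff_mem_of_many_roots)
    have "degree f \<le> max m m'"
      unfolding f_def
      by (intro degree_diff_le) (simp_all add: degree_monom_eq)
    then show "degree f < card S" using card m m' by simp
    show "poly f x \<in> P" if "x \<in> S" for x
    proof (cases "x = 0")
      case True
      then show ?thesis using m m' zero_mem by (simp add: f_def poly_monom power_0_left)
    next
      case False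
      then obtain T where T: "x = linear_product T" using \<open>x \<in> S\<close> by (auto simp: S_def)
      have "linear_product T ^ m \<approx> linear_product T ^ m'"
        unfolding linear_product_def prod_power_distrib
        by (intro ideal_cong_prod action power_root_of_unity z_power_r)
      then show ?thesis by (simp add: f_def T poly_monom ideal_cong_def)
    qed
    show "x = y" if "x \<in> S" "y \<in> S" "x \<approx> y" for x y
    proof -
      have "\<not> 0 \<approx> linear_product T" "\<not> linear_product T \<approx> 0" if "T \<in> A" for T
        using notin[OF that] uminus_mem[of "- linear_product T"] by (auto simp: ideal_cong_def)
      then show ?thesis using that inj unfolding S_def by blast
    qed
  qed
  then show False using ne one_notin by (simp add: f_def)
qed

text \<open>The power \<open>q\<close> acts like \<open>p * q\<close> followed by the inverse of the Frobenius map. Using \<open>q\<close> rather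
  than \<open>p * q\<close> keeps the exponents \<open>q ^ i * p ^ j\<close> with \<open>i, j \<le> s\<close> at most \<open>(p * q) ^ s\<close>; with \<open>p * q\<close>
  they could be as large as \<open>(p * q) ^ s * p ^ s\<close>, which may exceed \<open>2 ^ r\<close>.\<close>

lemma multiplicative_relation:
  assumes q_pos: "q > 0" and y: "[y ^ r = 1] (mod int p)"
    and action: "\<And>c. [c ^ r = 1] (mod int p) \<Longrightarrow> [:1, c:] ^ (p * q) \<approx> [:1, c * y:]"
    and s: "r < (s + 1)\<^sup>2" "(p * q) ^ s < 2 ^ r"
  obtains i j i' j' where "(i, j) \<noteq> (i', j')" "q ^ i * p ^ j = q ^ i' * p ^ j'"
proof -
  \<comment> \<open>\<open>z ^ (r - 1)\<close> is the inverse of \<open>z\<close>\<close>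
  define w where "w = y * z ^ (r - 1)"
  have w: "[w ^ r = 1] (mod int p)"
    unfolding w_def by (intro mult_root_of_unity power_root_of_unity y z_power_r)
  have "w * z = y * z ^ r"
    using r_pos by (simp add: w_def mult_ac flip: power_Suc)
  then have wz: "[w * z = y] (mod int p)"
    using cong_scalar_left[OF z_power_r, of y] by simp
  have action_q: "[:1, c:] ^ q \<approx> [:1, c * w:]" if c: "[c ^ r = 1] (mod int p)" for c
  proof (rule frobenius_inj)
    have "([:1, c:] ^ q) ^ p = [:1, c:] ^ (p * q)"
      by (simp add: mult.commute flip: power_mult)
    also have "\<dots> \<approx> [:1, c * y:]" by (rule action[OF c])
    also have "\<dots> \<approx> [:1, c * w * z:]"
      using cong_scalar_left[OF wz, of c] by (intro linear_cong) (simp add: cong_sym_eq mult.assoc)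
    also have "\<dots> \<approx> [:1, c * w:] ^ p" by (rule ideal_cong_sym[OF linear_power_p])
    finally show "([:1, c:] ^ q) ^ p \<approx> [:1, c * w:] ^ p" .
  qed
  have action_qp: "[:1, c:] ^ (q ^ i * p ^ j) \<approx> [:1, c * (w ^ i * z ^ j):]"
    if c: "[c ^ r = 1] (mod int p)" for c i j
  proof -
    have "[:1, c:] ^ (q ^ i * p ^ j) \<approx> [:1, c * w ^ i:] ^ (p ^ j)"
      unfolding power_mult by (intro ideal_cong_power linear_power_iterate action_q w c)
    also have "\<dots> \<approx> [:1, c * w ^ i * z ^ j:]"
      by (intro linear_power_iterate linear_power_p z_power_r mult_root_of_unity
          power_root_of_unity w c)
    finally show ?thesis by (simp only: mult.assoc)
  qed
  have bound: "q ^ i * p ^ j < 2 ^ r" if "i \<le> s" "j \<le> s" for i j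
  proof -
    have "q ^ i * p ^ j \<le> q ^ s * p ^ s"
      using that q_pos p_pos by (intro mult_le_mono power_increasing) auto
    then show ?thesis using s(2) by (simp add: power_mult_distrib mult.commute)
  qed
  obtain ij ij' where ij: "ij \<in> {..s} \<times> {..s}" "ij' \<in> {..s} \<times> {..s}" "ij \<noteq> ij'"
    and eq: "[(case ij of (i, j) \<Rightarrow> w ^ i * z ^ j) = (case ij' of (i, j) \<Rightarrow> w ^ i * z ^ j)] (mod int p)"
  proof (rule too_many_roots_of_unity[of "{..s} \<times> {..s}" "\<lambda>(i, j). w ^ i * z ^ j"])
    show "card ({..s} \<times> {..s}) > r" using s(1) by (simp add: power2_eq_square)
    show "[(case ij of (i, j) \<Rightarrow> w ^ i * z ^ j) ^ r = 1] (mod int p)" for ij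
      by (cases ij) (auto intro!: mult_root_of_unity power_root_of_unity w z_power_r)
  qed auto
  obtain i j i' j' where ij_eq: "ij = (i, j)" "ij' = (i', j')" by fastforce
  have "q ^ i * p ^ j = q ^ i' * p ^ j'"
  proof (rule equal_action_imp_equal)
    show "[:1, c:] ^ (q ^ i * p ^ j) \<approx> [:1, c:] ^ (q ^ i' * p ^ j')"
      if c: "[c ^ r = 1] (mod int p)" for c
    proof -
      note action_qp[OF c, of i j]
      also have "[:1, c * (w ^ i * z ^ j):] \<approx> [:1, c * (w ^ i' * z ^ j'):]"
        using eq ij_eq by (intro linear_cong cong_scalar_left) simp
      also note ideal_cong_sym[OF action_qp[OF c, of i' j']]
      finally show ?thesis .
    qed
  qed (use ij ij_eq bound q_pos p_pos in simp_all)
  then show ?thesis using that[of i j i' j'] ij(3) ij_eq by simp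
qed

end

section \<open>Arithmetic of the hypotheses\<close>

text \<open>The numbers congruent to 1 are closed under multiplication.\<close>

lemma cong_1_of_prime_divisors:
  fixes n m :: nat
  assumes "n > 0" "\<And>p. prime p \<Longrightarrow> p dvd n \<Longrightarrow> [p = 1] (mod m)"
  shows "[n = 1] (mod m)"
  using assms
proof (induction n rule: prime_divisors_induct)
  case (factor p x)
  then have "[p * x = 1 * 1] (mod m)" by (intro cong_mult) auto
  then show ?case by simp
qed auto

text \<open>Otherwise all prime divisors of \<open>n\<close>, and with them \<open>n\<close>, would be 1 modulo \<open>r ^ (\<alpha> + 1)\<close>.\<close>

lemma exists_exact_prime_divisor:
  fixes n r \<alpha> :: nat
  assumes "n > 0" "exactly_divides r \<alpha> (n - 1)"
  obtains p where "prime p" "p dvd n" "\<not> r ^ (\<alpha> + 1) dvd p - 1"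
proof (rule ccontr)
  assume *: "\<not> thesis"
  have "[n = 1] (mod r ^ (\<alpha> + 1))"
  proof (rule cong_1_of_prime_divisors)
    fix p assume p: "prime p" "p dvd n"
    then have "r ^ (\<alpha> + 1) dvd p - 1" using * that by blast
    then show "[p = 1] (mod r ^ (\<alpha> + 1))"
      using prime_gt_0_nat[OF p(1)] by (simp add: cong_altdef_nat)
  qed (use assms in auto)
  then have "r ^ (\<alpha> + 1) dvd n - 1"
    using assms(1) by (simp add: cong_altdef_nat)
  then show False using assms(2) by (simp add: exactly_divides_def)
qed

lemma ord_eq_prime_power:
  fixes a m r k :: nat
  assumes r: "prime r" and k: "k \<ge> 1"
    and "[a ^ (r ^ k) = 1] (mod m)" "\<not> [a ^ (r ^ (k - 1)) = 1] (mod m)"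
  shows "ord m a = r ^ k"
proof -
  have "ord m a dvd r ^ k" using assms by (simp only: ord_divides)
  then obtain l where l: "l \<le> k" "ord m a = r ^ l" using r by (auto simp: divides_primepow_nat)
  have "\<not> r ^ l dvd r ^ (k - 1)" using assms(4) by (simp only: ord_divides l(2)) simp
  then have "\<not> l \<le> k - 1" using le_imp_power_dvd by blast
  then have "l = k" using l(1) k by linarith
  then show ?thesis using l(2) by simp
qed

text \<open>The multiplicity of \<open>l\<close> in \<open>q ^ i * p ^ j\<close> is a fixed positive multiple of \<open>i\<close>, so it determines
  \<open>i\<close>, and then \<open>j\<close> is determined too.\<close>

lemma multiplicatively_independent:
  fixes p q l :: nat
  assumes p: "prime p" and l: "prime l" "l \<noteq> p" "l dvd q" and q: "q > 0"
    and eq: "q ^ i * p ^ j = q ^ i' * p ^ j'"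
  shows "(i, j) = (i', j')"
proof -
  have mult: "multiplicity l (q ^ i * p ^ j) = i * multiplicity l q" for i j
  proof -
    have "\<not> l dvd p ^ j" using l p prime_dvd_power primes_dvd_imp_eq by blast
    then have "multiplicity l (p ^ j) = 0" by (rule not_dvd_imp_multiplicity_0)
    then show ?thesis using l p q
      by (simp add: prime_elem_multiplicity_mult_distrib prime_elem_multiplicity_power_distrib prime_gt_0_nat)
  qed
  have "multiplicity l q > 0" using l q by (simp add: prime_multiplicity_gt_zero_iff)
  then have "i = i'" using mult[of i j] mult[of i' j'] eq by simp
  then have "p ^ j = p ^ j'" using eq q by simp
  then have "j = j'" using prime_gt_1_nat[OF p] by simp
  then show ?thesis using \<open>i = i'\<close> by simp
qed

lemma exists_other_prime_divisor:
  fixes n p :: nat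
  assumes "n > 1" "\<not> (\<exists>m k. k \<ge> 2 \<and> n = m ^ k)" "\<not> prime n" "prime p"
  obtains l where "prime l" "l \<noteq> p" "l dvd n"
proof -
  have "\<not> (\<exists>k. n = p ^ k)"
  proof
    assume "\<exists>k. n = p ^ k"
    then obtain k where k: "n = p ^ k" ..
    then have "\<not> k \<ge> 2" using assms(2) by blast
    then have "k = 0 \<or> k = 1" by auto
    then show False using k assms by auto
  qed
  then obtain l where "l \<in> prime_factors n" "l \<noteq> p"
    using Ex_other_prime_factor[of n p] assms by auto
  then show ?thesis using that by (auto simp: prime_factors_dvd)
qed

text \<open>\<open>r\<close> is not a square, so \<open>s\<^sup>2 < r\<close> strictly for \<open>s = \<lfloor>sqrt r\<rfloor>\<close>, whence
  \<open>s log n < sqrt r * sqrt r\<close>.\<close>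

lemma exists_small_exponent:
  fixes n r :: nat
  assumes n: "n > 0" and r: "prime r" "real r \<ge> (log 2 (real n))\<^sup>2"
  obtains s :: nat where "r < (s + 1)\<^sup>2" "n ^ s < 2 ^ r"
proof
  define s where "s = nat \<lfloor>sqrt r\<rfloor>"
  have s_le: "real s \<le> sqrt r" and s_gt: "sqrt r < real s + 1"
    by (simp_all add: s_def)
  have "(sqrt r)\<^sup>2 < (real s + 1)\<^sup>2" using s_gt by (intro power_strict_mono) auto
  then have "real r < real ((s + 1)\<^sup>2)" by (simp add: add.commute)
  then show "r < (s + 1)\<^sup>2" by (simp only: of_nat_less_iff)
  have "real s \<noteq> sqrt r"
  proof
    assume "real s = sqrt r"
    then have "real (s\<^sup>2) = real r" by simp
    then have "s\<^sup>2 = r" by (simp only: of_nat_eq_iff)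
    then show False using r(1) by (auto simp: prime_power_iff)
  qed
  then have s: "real s < sqrt r" using s_le by simp
  have log: "0 \<le> log 2 n" "log 2 n \<le> sqrt r"
    using n r(2) real_le_rsqrt by auto
  have "s * log 2 n \<le> s * sqrt r" using log by (intro mult_left_mono) auto
  also have "\<dots> < sqrt r * sqrt r"
    using s prime_gt_0_nat[OF r(1)] by (intro mult_strict_right_mono) auto
  also have "\<dots> = r" by simp
  finally have "2 powr (log 2 n * s) < 2 powr r" by (simp add: mult.commute)
  then have "real n powr real s < 2 powr r"
    using n by (simp flip: powr_powr)
  then have "real (n ^ s) < real (2 ^ r)"
    using n by (simp add: powr_realpow)
  then show "n ^ s < 2 ^ r" by (simp only: of_nat_less_iff)
qed

section \<open>The primality criterion\<close>

theorem theorem1: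
  fixes n r \<alpha> :: nat and a :: int
  assumes "n > 0"
    and "\<not> (\<exists>(m::int) (k::nat). k \<ge> 2 \<and> int n = m ^ k)"
    and "prime r"
    and "\<alpha> \<ge> 1"
    and "exactly_divides r \<alpha> (n - 1)"
    and "real r \<ge> (log 2 (real n)) ^ 2"
    and "1 < a" and "a < int n"
    and "[a ^ (r ^ \<alpha>) = 1] (mod int n)"
    and "gcd (a ^ (r ^ (\<alpha> - 1)) - 1) (int n) = 1"
    and "cong_mod_ideal ((1 + [:0, 1:]) ^ n) (1 + [:0, 1:] ^ n)
           {[:int n:], [:0, 1:] ^ r - [:a:]}"
  shows "prime n"
proof (rule ccontr)
  assume not_prime: "\<not> prime n"
  have n: "n > 1" using assms(7,8) by simp
  have n_not_power: "\<not> (\<exists>m k. k \<ge> 2 \<and> n = m ^ k)"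
  proof
    assume "\<exists>m k. k \<ge> 2 \<and> n = m ^ k"
    then obtain m k where "k \<ge> 2" "int n = int m ^ k" by auto
    then show False using assms(2) by blast
  qed
  obtain p where p: "prime p" "p dvd n" "\<not> r ^ (\<alpha> + 1) dvd p - 1"
    using exists_exact_prime_divisor[OF assms(1,5)] .
  have p_gt: "p > 1" using p(1) prime_gt_1_nat by blast
  obtain q where n_eq: "n = p * q" using p(2) by blast
  have q: "q > 0" using n n_eq by (cases q) auto
  define b where "b = nat a"
  have a_eq: "a = int b" using assms(7) by (simp add: b_def)
  have b_pow: "[a ^ k = 1] (mod int m) \<longleftrightarrow> [b ^ k = 1] (mod m)" for k m
    using cong_int_iff[of "b ^ k" 1 m] by (simp add: a_eq)
  have pow_n: "[b ^ (r ^ \<alpha>) = 1] (mod n)" using assms(9) b_pow by blast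
  then have pow_p: "[b ^ (r ^ \<alpha>) = 1] (mod p)" using p(2) cong_dvd_modulus_nat by blast
  have not_pow_p: "\<not> [b ^ (r ^ (\<alpha> - 1)) = 1] (mod p)"
  proof
    assume "[b ^ (r ^ (\<alpha> - 1)) = 1] (mod p)"
    then have "int p dvd a ^ (r ^ (\<alpha> - 1)) - 1" using b_pow by (simp add: cong_iff_dvd_diff)
    moreover have "int p dvd int n" using p(2) by simp
    ultimately have "int p dvd gcd (a ^ (r ^ (\<alpha> - 1)) - 1) (int n)" by (rule gcd_greatest)
    then have "int p dvd 1" by (simp only: assms(10))
    then show False using p_gt by simp
  qed
  have ord: "ord p b = r ^ \<alpha>"
    by (rule ord_eq_prime_power[OF assms(3,4) pow_p not_pow_p])
  have r_alpha: "r ^ \<alpha> > 0" using assms(3) prime_gt_0_nat by simp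
  have p_b: "\<not> p dvd b"
  proof
    assume "p dvd b"
    then have "p dvd b ^ (r ^ \<alpha>)" using r_alpha by (meson dvd_power dvd_trans)
    then show False using pow_p p_gt by (simp add: cong_def mod_eq_0_iff_dvd)
  qed
  have r_alpha_p: "r ^ \<alpha> dvd p - 1"
    using fermat_theorem[OF p(1) p_b] ord by (simp only: ord_divides)
  have r_dvd_alpha: "r dvd r ^ \<alpha>" using assms(4) by simp
  have r_p: "r dvd p - 1" using r_dvd_alpha r_alpha_p by (rule dvd_trans)
  \<comment> \<open>The next fact fails for the prime divisors of \<open>n\<close> with \<open>r ^ (\<alpha> + 1)\<close> dividing \<open>p - 1\<close>, which is
    why \<open>p\<close> was chosen without this property.\<close>
  have not_power: "\<not> [a ^ ((p - 1) div r) = 1] (mod int p)"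
  proof
    assume "[a ^ ((p - 1) div r) = 1] (mod int p)"
    then have "r ^ \<alpha> dvd (p - 1) div r" by (simp only: b_pow ord_divides ord)
    then have "r ^ \<alpha> * r dvd (p - 1) div r * r" by (rule mult_dvd_mono) simp
    then have "r ^ (\<alpha> + 1) dvd p - 1"
      unfolding dvd_div_mult_self[OF r_p] by (simp add: mult.commute)
    then show False using p(3) by contradiction
  qed
  obtain P where "radical_extension P p r a"
    using exists_radical_extension[OF p(1) assms(3) r_p _ not_power] p_b a_eq by auto
  then interpret radical_extension P p r a .
  have r_alpha_n: "r ^ \<alpha> dvd n - 1" using assms(5) by (simp add: exactly_divides_def)
  have r_n: "r dvd n - 1" using r_dvd_alpha r_alpha_n by (rule dvd_trans)
  have y: "[(a ^ ((n - 1) div r)) ^ r = 1] (mod int p)"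
  proof -
    have "ord p b dvd n - 1" using ord r_alpha_n by simp
    then have "[a ^ (n - 1) = 1] (mod int p)" by (simp only: b_pow ord_divides)
    then show ?thesis using r_n by (simp flip: power_mult)
  qed
  obtain u v where uv: "(1 + [:0, 1:]) ^ n - (1 + [:0, 1:] ^ n)
      = u * [:int n:] + v * ([:0, 1:] ^ r - [:a:])"
    using assms(11) unfolding cong_mod_ideal_pair_iff by blast
  obtain s where s: "r < (s + 1)\<^sup>2" "n ^ s < 2 ^ r"
    using exists_small_exponent[OF assms(1,3,6)] .
  have action: "ideal_cong ([:1, c:] ^ (p * q)) [:1, c * a ^ ((n - 1) div r):]"
    if "[c ^ r = 1] (mod int p)" for c
    using linear_power_n[OF uv p(2) assms(1) r_n that] n_eq by simp
  obtain i j i' j' where rel: "(i, j) \<noteq> (i', j')" "q ^ i * p ^ j = q ^ i' * p ^ j'"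
  proof (rule multiplicative_relation[OF q y])
    show "(p * q) ^ s < 2 ^ r" using s(2) n_eq by simp
  qed (use action s(1) in auto)
  obtain l where l: "prime l" "l \<noteq> p" "l dvd n"
    using exists_other_prime_divisor[OF n n_not_power not_prime p(1)] .
  then have "l dvd q" using n_eq p(1) by (auto simp: prime_dvd_mult_iff dest: primes_dvd_imp_eq)
  then show False
    using multiplicatively_independent[OF p(1) l(1,2) _ q rel(2)] rel(1) by simp
qed

end
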